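(* Let $\bm p_0,\dots,\bm p_{m-1}$ be distinct points in $\mathbb{R}^d$ whose convex hull $\Omega$ has dimension $d$, and let $\lambda\in(0,1)$. If $\lambda\ge d/(d+1)$, then $S_\lambda=\Omega$.
   Context: $f_j(\bm x)=\lambda\bm x+(1-\lambda)\bm p_j$ for $\bm x\in\mathbb{R}^d$, $j=0,\dots,m-1$. The attractor $S_\lambda$ is the unique nonempty compact set with $S_\lambda=\bigcup_{j=0}^{m-1}f_j(S_\lambda)$. $\Omega=\mathrm{conv}(\bm p_0,\dots,\bm p_{m-1})$. *)

theory Defs
  imports "HOL-Analysis.Analysis"
begin

definition homothety :: "real \<Rightarrow> real ^ 'n \<Rightarrow> real ^ 'n \<Rightarrow> real ^ 'n" where
  "homothety lam q x = lam *\<^sub>R x + (1 - lam) *\<^sub>R q"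

definition is_attractor :: "real \<Rightarrow> nat \<Rightarrow> (nat \<Rightarrow> real ^ 'n) \<Rightarrow> (real ^ 'n) set \<Rightarrow> bool" where
  "is_attractor lam m p S \<longleftrightarrow>
     compact S \<and> S \<noteq> {} \<and> S = (\<Union>j<m. homothety lam (p j) ` S)"

text \<open>Only \<open>p 0, \<dots>, p (m - 1)\<close> matter. The description is well defined for
  \<open>0 < lam < 1\<close> and \<open>m > 0\<close>, by \<open>ex1_attractor\<close> below.\<close>

definition attractor :: "real \<Rightarrow> nat \<Rightarrow> (nat \<Rightarrow> real ^ 'n) \<Rightarrow> (real ^ 'n) set" where
  "attractor lam m p = (THE S. is_attractor lam m p S)"

lemma dist_homothety:
  assumes "0 < lam"
  shows "dist (homothety lam q x) (homothety lam q y) = lam * dist x y"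
proof -
  have "homothety lam q x - homothety lam q y = lam *\<^sub>R (x - y)"
    by (simp add: homothety_def algebra_simps)
  then show ?thesis using assms by (simp add: dist_norm)
qed

lemma attractor_subset:
  assumes l: "0 < lam" "lam < 1" and S: "is_attractor lam m p S" and T: "is_attractor lam m p T"
  shows "S \<subseteq> T"
proof -
  have cS: "compact S" "S \<noteq> {}" and eS: "S = (\<Union>j<m. homothety lam (p j) ` S)"
    using S unfolding is_attractor_def by blast+
  have cT: "compact T" "T \<noteq> {}" and eT: "T = (\<Union>j<m. homothety lam (p j) ` T)"
    using T unfolding is_attractor_def by blast+
  have "continuous_on S (\<lambda>x. infdist x T)" by (intro continuous_intros)
  then obtain x where x: "x \<in> S" "\<And>y. y \<in> S \<Longrightarrow> infdist y T \<le> infdist x T"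
    using continuous_attains_sup[OF cS] by blast
  obtain j s where j: "j < m" "s \<in> S" "x = homothety lam (p j) s" using x(1) eS by blast
  obtain t where t: "t \<in> T" "infdist s T = dist s t"
    using infdist_attains_inf[OF compact_imp_closed[OF cT(1)] cT(2)] by blast
  have "homothety lam (p j) t \<in> T" using eT j(1) t(1) by blast
  then have "infdist x T \<le> dist x (homothety lam (p j) t)" by (rule infdist_le)
  also have "\<dots> = lam * infdist s T" using l t j by (simp add: dist_homothety)
  also have "\<dots> \<le> lam * infdist x T" using x(2)[OF j(2)] l by simp
  finally have "(1 - lam) * infdist x T \<le> 0" by (simp add: algebra_simps)
  then have "infdist x T \<le> 0" using l by (simp add: mult_le_0_iff)
  then have "\<And>y. y \<in> S \<Longrightarrow> infdist y T = 0"
    using x(2) infdist_nonneg by (meson order_antisym order_trans)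
  then show ?thesis
    using in_closed_iff_infdist_zero[OF compact_imp_closed[OF cT(1)] cT(2)] by blast
qed

lemma ex_attractor:
  fixes p :: "nat \<Rightarrow> real ^ 'n"
  assumes l: "0 < lam" "lam < 1" and m: "0 < m"
  shows "\<exists>S. is_attractor lam m p S"
proof -
  define F where "F S = (\<Union>j<m. homothety lam (p j) ` S)" for S
  define R where "R = (\<Sum>j<m. norm (p j))"
  define K where "K n = (F ^^ n) (cball 0 R)" for n :: nat
  have R0: "0 \<le> R" unfolding R_def by (simp add: sum_nonneg)
  have pR: "norm (p j) \<le> R" if "j < m" for j
    unfolding R_def using that by (intro member_le_sum) auto
  have mono: "F A \<subseteq> F B" if "A \<subseteq> B" for A B using that unfolding F_def by blast
  have "F (cball 0 R) \<subseteq> cball 0 R"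
  proof
    fix y assume "y \<in> F (cball 0 R)"
    then obtain j x where jx: "j < m" "norm x \<le> R" "y = homothety lam (p j) x"
      unfolding F_def by auto
    have "y \<in> cball 0 R"
      unfolding jx(3) homothety_def
      by (rule convexD[OF convex_cball]) (use jx pR l in auto)
    then show "y \<in> cball 0 R" .
  qed
  then have dec1: "K (Suc n) \<subseteq> K n" for n
    by (induction n) (auto simp: K_def dest: mono)
  then have dec: "K n \<subseteq> K k" if "k \<le> n" for k n
    using that by (rule lift_Suc_antimono_le)
  have comp: "compact (K n)" for n
  proof (induction n)
    case 0 then show ?case by (simp add: K_def)
  next
    case (Suc n)
    have "compact (homothety lam (p j) ` K n)" for j
      unfolding homothety_def by (intro compact_continuous_image continuous_intros Suc)
    then show ?case by (auto simp: K_def F_def)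
  qed
  have ne: "K n \<noteq> {}" for n
    by (induction n) (use R0 m in \<open>auto simp: K_def F_def\<close>)
  define S where "S = (\<Inter>n. K n)"
  have "S \<noteq> {}" unfolding S_def by (rule compact_nest) (use comp ne dec in auto)
  moreover have "compact S"
    unfolding S_def by (rule compact_Inter) (use comp in auto)
  moreover have "F S \<subseteq> S"
  proof -
    have "F S \<subseteq> K n" for n
    proof -
      have "F S \<subseteq> F (K n)" by (rule mono) (auto simp: S_def)
      also have "F (K n) = K (Suc n)" by (simp add: K_def)
      finally show ?thesis using dec1 by blast
    qed
    then show ?thesis unfolding S_def by blast
  qed
  moreover have "S \<subseteq> F S"
  proof
    fix x assume x: "x \<in> S"
    show "x \<in> F S"
    proof (rule ccontr)
      assume neg: "x \<notin> F S"
      have "\<exists>n. x \<notin> homothety lam (p j) ` K n" if j: "j < m" for j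
      proof (rule ccontr)
        assume "\<not> ?thesis"
        then have all: "\<And>n. x \<in> homothety lam (p j) ` K n" by blast
        have inj: "inj (homothety lam (p j))"
          using l by (auto simp: inj_def homothety_def)
        obtain y where y: "x = homothety lam (p j) y" using all by blast
        have "y \<in> K n" for n using all[of n] y inj by (auto dest: injD)
        then show False using neg y j unfolding F_def S_def by blast
      qed
      then obtain N where N: "\<And>j. j < m \<Longrightarrow> x \<notin> homothety lam (p j) ` K (N j)" by metis
      define M where "M = (\<Sum>j<m. N j)"
      have "N j \<le> M" if "j < m" for j unfolding M_def using that by (intro member_le_sum) auto
      then have "x \<notin> F (K M)" using N dec unfolding F_def by blast
      moreover have "x \<in> K (Suc M)" using x unfolding S_def by blast
      ultimately show False by (simp add: K_def)
    qed
  qed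
  ultimately show ?thesis unfolding is_attractor_def F_def by blast
qed

lemma ex1_attractor:
  assumes "0 < lam" "lam < 1" "0 < m"
  shows "\<exists>!S. is_attractor lam m p S"
  using ex_attractor[OF assms] attractor_subset[OF assms(1,2)] by (meson subset_antisym)

end

theory Submission imports Defs begin

text \<open>
  Since the attractor is the only nonempty compact set that the contractions jointly reproduce, it is
  enough that the hull \<open>\<Omega>\<close> of the points \<open>p j\<close> is the union of its own images.
  Each image lies in \<open>\<Omega>\<close> by convexity. For the converse, a point \<open>x\<close> of \<open>\<Omega>\<close> belongs to
  the image of \<open>\<Omega>\<close> under the contraction towards a vertex \<open>v\<close> as soon as \<open>x\<close> is a convex
  combination of the vertices in which \<open>v\<close> has weight at least \<open>1 - lam\<close>: a part \<open>1 - lam\<close> of that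
  weight can be split off, and what is left is \<open>lam\<close> times a point of \<open>\<Omega>\<close>
  (\<open>convex_hull_peel_heavy_vertex\<close>). By Caratheodory's theorem, \<open>x\<close> is a convex combination of
  at most \<open>d + 1\<close> vertices, so one of them has weight at least \<open>1 / (d + 1)\<close>,
  and \<open>lam \<ge> d / (d + 1)\<close> says exactly that \<open>1 / (d + 1) \<ge> 1 - lam\<close>.
\<close>

lemma ex_weight_ge_average:
  fixes u :: "'a \<Rightarrow> real"
  assumes "finite S" "S \<noteq> {}" and "sum u S = 1"
  obtains v where "v \<in> S" "1 / real (card S) \<le> u v"
proof -
  have c: "0 < real (card S)" using assms by (simp add: card_gt_0_iff)
  have "\<exists>v\<in>S. 1 / real (card S) \<le> u v"
  proof (rule ccontr)
    assume "\<not> ?thesis"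
    then have "sum u S < (\<Sum>v\<in>S. 1 / real (card S))"
      using assms by (intro sum_strict_mono) auto
    then show False using c assms(3) by simp
  qed
  then show thesis using that by blast
qed

text \<open>Moving weight \<open>1 - lam\<close> away from \<open>v\<close> leaves nonnegative weights of total \<open>lam\<close>;
  dividing these by \<open>lam\<close> gives the preimage \<open>y\<close> of the point under the contraction towards \<open>v\<close>.\<close>

lemma convex_hull_peel_heavy_vertex:
  fixes S :: "'a::real_vector set"
  assumes fin: "finite S" and v: "v \<in> S" and lam: "0 < lam"
    and u: "\<And>w. w \<in> S \<Longrightarrow> 0 \<le> u w" "sum u S = 1" and heavy: "1 - lam \<le> u v"
  obtains y where "y \<in> convex hull S" "(\<Sum>w\<in>S. u w *\<^sub>R w) = lam *\<^sub>R y + (1 - lam) *\<^sub>R v"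
proof
  define u' where "u' w = (u w - (if w = v then 1 - lam else 0)) / lam" for w
  let ?y = "\<Sum>w\<in>S. u' w *\<^sub>R w"
  have "0 \<le> u' w" if "w \<in> S" for w
    using u(1)[OF that] heavy lam by (auto simp: u'_def)
  moreover have "sum u' S = 1"
    using fin v lam u(2)
    by (simp add: u'_def sum_divide_distrib[symmetric] sum_subtractf)
  ultimately show "?y \<in> convex hull S"
    using fin by (auto simp: convex_hull_finite)
  have "lam *\<^sub>R ?y = (\<Sum>w\<in>S. u w *\<^sub>R w - (if w = v then (1 - lam) *\<^sub>R v else 0))"
    unfolding scaleR_sum_right
    by (rule sum.cong) (use lam in \<open>auto simp: u'_def scaleR_left_diff_distrib\<close>)
  also have "\<dots> = (\<Sum>w\<in>S. u w *\<^sub>R w) - (1 - lam) *\<^sub>R v"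
    using fin v by (simp add: sum_subtractf)
  finally show "(\<Sum>w\<in>S. u w *\<^sub>R w) = lam *\<^sub>R ?y + (1 - lam) *\<^sub>R v" by simp
qed

text \<open>The dimension enters only through the number of points that Caratheodory's theorem allows.\<close>

lemma convex_hull_covered_by_contractions:
  fixes P :: "'a::euclidean_space set"
  assumes x: "x \<in> convex hull P" and lam: "0 < lam" and ge: "real DIM('a) / (real DIM('a) + 1) \<le> lam"
  obtains v y where "v \<in> P" "y \<in> convex hull P" "x = lam *\<^sub>R y + (1 - lam) *\<^sub>R v"
proof -
  obtain S where S: "finite S" "S \<subseteq> P" "card S \<le> DIM('a) + 1" "x \<in> convex hull S"
    using x by (auto simp: caratheodory[of P])
  obtain u where u: "\<And>w. w \<in> S \<Longrightarrow> 0 \<le> u w" "sum u S = 1" "(\<Sum>w\<in>S. u w *\<^sub>R w) = x"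
    using S(1,4) by (auto simp: convex_hull_finite)
  have ne: "S \<noteq> {}" using S(4) by auto
  obtain v where v: "v \<in> S" "1 / real (card S) \<le> u v"
    using ex_weight_ge_average[OF S(1) ne u(2)] .
  have "1 - lam \<le> 1 / (real DIM('a) + 1)"
    using ge by (simp add: field_simps)
  also have "\<dots> \<le> 1 / real (card S)"
    using S(1,3) ne by (intro divide_left_mono) (auto simp: card_gt_0_iff)
  finally have "1 - lam \<le> u v" using v(2) by linarith
  then obtain y where "y \<in> convex hull S" "x = lam *\<^sub>R y + (1 - lam) *\<^sub>R v"
    using convex_hull_peel_heavy_vertex[OF S(1) v(1) lam u(1,2)] u(3) by metis
  then show thesis
    using that v(1) S(2) hull_mono[OF S(2)] by blast
qed

theorem proposition2p4:
  fixes p :: "nat \<Rightarrow> real ^ 'n" and m :: nat and lam :: real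
  assumes "inj_on p {..<m}"
    and "aff_dim (convex hull (p ` {..<m})) = int CARD('n)"
    and "0 < lam" and "lam < 1"
    and "lam \<ge> real CARD('n) / (real CARD('n) + 1)"
  shows "attractor lam m p = convex hull (p ` {..<m})"
proof -
  let ?\<Omega> = "convex hull (p ` {..<m})"
  have ne: "?\<Omega> \<noteq> {}" using assms(2) by (auto simp: aff_dim_empty)
  then have m: "0 < m" by (cases m) auto
  have "homothety lam (p j) ` ?\<Omega> \<subseteq> ?\<Omega>" if "j < m" for j
  proof -
    have "p j \<in> ?\<Omega>" using that by (intro hull_inc) auto
    then show ?thesis
      using assms(3,4) by (auto simp: homothety_def intro!: convexD[OF convex_convex_hull])
  qed
  moreover have "?\<Omega> \<subseteq> (\<Union>j<m. homothety lam (p j) ` ?\<Omega>)"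
  proof
    fix x assume "x \<in> ?\<Omega>"
    then obtain v y where "v \<in> p ` {..<m}" "y \<in> ?\<Omega>" "x = lam *\<^sub>R y + (1 - lam) *\<^sub>R v"
      using convex_hull_covered_by_contractions[of x "p ` {..<m}" lam] assms(3,5) by auto
    then show "x \<in> (\<Union>j<m. homothety lam (p j) ` ?\<Omega>)"
      by (auto simp: homothety_def)
  qed
  ultimately have "?\<Omega> = (\<Union>j<m. homothety lam (p j) ` ?\<Omega>)" by blast
  moreover have "compact ?\<Omega>"
    by (intro finite_imp_compact_convex_hull) simp
  ultimately have "is_attractor lam m p ?\<Omega>"
    using ne unfolding is_attractor_def by blast
  then show ?thesis
    unfolding attractor_def by (rule the1_equality[OF ex1_attractor[OF assms(3,4) m]])
qed

end
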